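(* For all $L,h\in\mathbb{Z}$, $$p(L,h)=\begin{cases}0&\text{if }L<0\text{ or }(L=0\text{ and }h\ne0),\\ 1&\text{if }L\ge0\text{ and }(h=0\text{ or }h=L),\\ p(L,h\bmod L)&\text{if }L>0\text{ and }(h<0\text{ or }h>L),\\ p(L-h-1,h)+p(h-1,L-1)&\text{otherwise.}\end{cases}$$
   Context: For a finite word $w$ over $\{0,1\}$, $|w|$ is its length and $|w|_0,|w|_1$ are its numbers of $0$'s and $1$'s; $|w|_1$ is the height of $w$. A subword means a contiguous factor. A word $w$ is balanced if for all finite subwords $u,v$ of $w$ with $|u|=|v|$ one has $\bigl||u|_0-|v|_0\bigr|\le 1$. For $0\le h\le L$, $\mathbb{P}(L,h)$ is the set of balanced palindromes in $\{0,1\}^*$ of length $L$ and height $h$. The function $p:\mathbb{Z}^2\to\mathbb{N}$ is defined by $p(L,h)=\#\mathbb{P}(L,h\bmod L)$ if $L>0$ (with $h\bmod L\in\{0,\dots,L-1\}$), $p(0,0)=1$, and $p(L,h)=0$ if $L<0$ or if $L=0$ and $h\ne0$. *)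

theory Defs
  imports Main "HOL-Library.Sublist"
begin

text \<open>
  Words over the alphabet 0, 1 are represented as boolean lists, the letter 0 being
  \<open>False\<close> and the letter 1 being \<open>True\<close>.
  The library predicate \<^const>\<open>sublist\<close> means contiguous factor (the scattered
  subsequence relation is \<^const>\<open>subseq\<close>).
\<close>

type_synonym word01 = "bool list"

definition height :: "word01 \<Rightarrow> nat" where
  "height w = count_list w True"

definition balanced :: "word01 \<Rightarrow> bool" where
  "balanced w \<longleftrightarrow>
     (\<forall>u v. sublist u w \<longrightarrow> sublist v w \<longrightarrow> length u = length v \<longrightarrow>
        \<bar>int (count_list u False) - int (count_list v False)\<bar> \<le> 1)"

definition palindrome :: "word01 \<Rightarrow> bool" where
  "palindrome w \<longleftrightarrow> rev w = w"

definition bal_pals :: "nat \<Rightarrow> nat \<Rightarrow> word01 set" where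
  "bal_pals L h = {w. balanced w \<and> palindrome w \<and> length w = L \<and> height w = h}"

text \<open>
  For \<open>L > 0\<close> the integer \<open>h mod L\<close> lies in \<open>{0..<L}\<close>, so the conversions by
  \<^const>\<open>nat\<close> do not truncate.
\<close>

definition p :: "int \<Rightarrow> int \<Rightarrow> nat" where
  "p L h =
     (if L > 0 then card (bal_pals (nat L) (nat (h mod L)))
      else if L = 0 \<and> h = 0 then 1
      else 0)"

end

theory Submission
  imports Defs
begin

text \<open>
  A word that starts and ends with 0 is determined by the list of lengths of its blocks of 1's
  between consecutive 0's.  The word is balanced iff sums over equally long factors of this
  list differ by at most 1.  The entries then take only two values \<open>k\<close>, \<open>k + 1\<close>,
  and subtracting \<open>k\<close> gives a balanced word of length \<open>L - h - 1\<close> and height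
  \<open>h mod (L - h - 1)\<close>.  This counts the balanced palindromes that start with 0;
  exchanging the letters counts the others.
\<close>

section \<open>Words that start and end with 0, encoded by their gaps\<close>

fun word_of_gaps :: "nat list \<Rightarrow> word01" where
  "word_of_gaps [] = [False]"
| "word_of_gaps (g # a) = False # replicate g True @ word_of_gaps a"

text \<open>A one-sided inequality suffices because \<open>x\<close> and \<open>y\<close> may be
  exchanged; it avoids truncated subtraction.\<close>

definition balanced_nats :: "nat list \<Rightarrow> bool" where
  "balanced_nats a \<longleftrightarrow>
     (\<forall>x y. sublist x a \<longrightarrow> sublist y a \<longrightarrow> length x = length y \<longrightarrow> sum_list y \<le> sum_list x + 1)"

lemma count_list_replicate: "count_list (replicate n x) y = (if x = y then n else 0)"
  by (induction n) auto

lemma length_eq_count_list_bool: "length w = count_list w False + count_list w True"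
  by (induction w) auto

lemma count_False_word_of_gaps: "count_list (word_of_gaps a) False = length a + 1"
  by (induction a) (auto simp: count_list_replicate)

lemma count_True_word_of_gaps: "count_list (word_of_gaps a) True = sum_list a"
  by (induction a) (auto simp: count_list_replicate)

lemma length_word_of_gaps: "length (word_of_gaps a) = sum_list a + length a + 1"
  by (simp add: length_eq_count_list_bool count_False_word_of_gaps count_True_word_of_gaps)

lemma word_of_gaps_neq_Nil [simp]: "word_of_gaps a \<noteq> []"
  by (cases a) auto

lemma hd_word_of_gaps [simp]: "\<not> hd (word_of_gaps a)"
  by (cases a) auto

lemma word_of_gaps_neq_True_Cons [simp]: "word_of_gaps a \<noteq> True # w" "True # w \<noteq> word_of_gaps a"
  by (cases a; simp)+

text \<open>The word behind the run begins with 0, so the run of 1's ends at the same place on both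
  sides.\<close>

lemma replicate_word_of_gaps_eq:
  assumes "replicate g True @ word_of_gaps a = replicate g' True @ word_of_gaps a'"
  shows "g = g' \<and> word_of_gaps a = word_of_gaps a'"
  using assms
proof (induction g arbitrary: g')
  case 0
  then show ?case by (cases g') auto
next
  case (Suc g)
  then show ?case by (cases g') auto
qed

lemma word_of_gaps_eq_iff [simp]: "word_of_gaps a = word_of_gaps b \<longleftrightarrow> a = b"
proof
  assume "word_of_gaps a = word_of_gaps b"
  then show "a = b"
  proof (induction a arbitrary: b)
    case Nil
    then show ?case by (cases b) auto
  next
    case (Cons g a)
    then show ?case by (cases b) (auto dest: replicate_word_of_gaps_eq)
  qed
qed simp

lemma word_of_gaps_snoc: "word_of_gaps (a @ [g]) = word_of_gaps a @ replicate g True @ [False]"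
  by (induction a) auto

lemma rev_word_of_gaps: "rev (word_of_gaps a) = word_of_gaps (rev a)"
  by (induction a) (auto simp: word_of_gaps_snoc)

lemma palindrome_word_of_gaps: "palindrome (word_of_gaps a) \<longleftrightarrow> rev a = a"
  by (simp add: palindrome_def rev_word_of_gaps)

lemma ex_replicate_word_of_gaps:
  assumes "w \<noteq> []" "\<not> last w"
  shows "\<exists>r a. w = replicate r True @ word_of_gaps a"
  using assms
proof (induction w)
  case (Cons b w)
  show ?case
  proof (cases "w = []")
    case True
    with Cons.prems have "b # w = replicate 0 True @ word_of_gaps []" by simp
    then show ?thesis by blast
  next
    case False
    with Cons obtain r a where w: "w = replicate r True @ word_of_gaps a" by auto
    show ?thesis
    proof (cases b)
      case True
      with w have "b # w = replicate (Suc r) True @ word_of_gaps a" by simp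
      then show ?thesis by blast
    next
      case False
      with w have "b # w = replicate 0 True @ word_of_gaps (r # a)" by simp
      then show ?thesis by blast
    qed
  qed
qed simp

lemma ex_word_of_gaps:
  assumes "w \<noteq> []" "\<not> hd w" "\<not> last w"
  shows "\<exists>a. w = word_of_gaps a"
proof -
  obtain r a where w: "w = replicate r True @ word_of_gaps a"
    using ex_replicate_word_of_gaps assms by blast
  with assms(2) have "r = 0" by (cases r) auto
  with w show ?thesis by auto
qed

section \<open>Factors of a word and factors of its gap list\<close>

lemma sublist_word_of_gaps:
  assumes "sublist x a"
  shows "sublist (word_of_gaps x) (word_of_gaps a)"
proof -
  \<comment> \<open>Neighbouring pieces of a gap list share the 0 between them: \<open>p\<close> is
    the word of \<open>ps\<close> without its last 0, and \<open>s\<close> below is the word of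
    \<open>ss\<close> without its first 0.\<close>
  have "\<exists>p. word_of_gaps (ps @ b) = p @ word_of_gaps b" for ps b
  proof (induction ps)
    case Nil
    show ?case by (rule exI[of _ "[]"]) simp
  next
    case (Cons g ps)
    then obtain p where "word_of_gaps (ps @ b) = p @ word_of_gaps b" by blast
    then show ?case by (intro exI[of _ "False # replicate g True @ p"]) simp
  qed
  moreover have "\<exists>s. word_of_gaps (b @ ss) = word_of_gaps b @ s" for b ss
  proof (induction b)
    case Nil
    then show ?case by (cases ss) auto
  qed auto
  ultimately show ?thesis
    using assms unfolding sublist_def by metis
qed

lemma sublist_replicate_append:
  assumes "sublist B (replicate g x @ w)"
  shows "(\<exists>r\<le>g. prefix B (replicate r x @ w)) \<or> sublist B w"
  using assms
proof (induction g)
  case (Suc g)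
  then consider "prefix B (replicate (Suc g) x @ w)" | "sublist B (replicate g x @ w)"
    by (auto simp: sublist_Cons_right)
  then show ?case
  proof cases
    case 2
    then show ?thesis using Suc.IH le_SucI by blast
  qed blast
qed simp

text \<open>Deleting everything before an occurrence of \<open>B\<close> leaves \<open>r\<close>
  1's, cut from a gap \<open>g\<close>, and then the word of the following gaps \<open>a'\<close>.
  The alternative with \<open>r = 0\<close> is needed since no gap precedes the first 0 of the
  word.\<close>

lemma sublist_word_of_gapsE:
  assumes "sublist B (word_of_gaps a)"
  obtains r a' where "prefix B (replicate r True @ word_of_gaps a')"
    "r = 0 \<and> suffix a' a \<or> (\<exists>g\<ge>r. suffix (g # a') a)"
proof -
  have "\<exists>r a'. prefix B (replicate r True @ word_of_gaps a') \<and>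
      (r = 0 \<and> suffix a' a \<or> (\<exists>g\<ge>r. suffix (g # a') a))"
    using assms
  proof (induction a)
    case Nil
    then have "prefix B (replicate 0 True @ word_of_gaps [])"
      by (auto simp: sublist_Cons_right)
    then show ?case by blast
  next
    case (Cons g a)
    then consider "prefix B (word_of_gaps (g # a))"
      | "sublist B (replicate g True @ word_of_gaps a)"
      by (auto simp: sublist_Cons_right)
    then show ?case
    proof cases
      case 1
      then show ?thesis
        by (metis append_Nil replicate_0 suffix_order.refl)
    next
      case 2
      then consider r where "r \<le> g" "prefix B (replicate r True @ word_of_gaps a)"
        | "sublist B (word_of_gaps a)"
        using sublist_replicate_append[OF 2] by blast
      then show ?thesis
      proof cases
        case 1
        then show ?thesis by blast
      next
        case 2
        then show ?thesis using Cons.IH by (meson suffix_ConsI)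
      qed
    qed
  qed
  then show thesis using that by blast
qed

lemma prefix_replicate_appendE:
  assumes "prefix B (replicate r x @ w)"
  obtains i where "i \<le> r" "B = replicate i x"
  | B' where "B = replicate r x @ B'" "prefix B' w"
proof -
  consider "prefix B (replicate r x)" | B' where "B = replicate r x @ B'" "prefix B' w"
    using assms by (auto simp: prefix_append)
  then show thesis
  proof cases
    case 1
    then obtain C where C: "replicate r x = B @ C" by (auto simp: prefix_def)
    have "length B \<le> r" using arg_cong[OF C, of length] by simp
    moreover have "B = take (length B) (replicate r x)" by (simp add: C)
    ultimately have "B = replicate (length B) x" by (metis take_replicate min.absorb1)
    with \<open>length B \<le> r\<close> show thesis by (rule that(1))
  qed (rule that(2))
qed

text \<open>Let \<open>B\<close> have \<open>m\<close> 0's. Its 1's lie in the initial run and in at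
  most the first \<open>m\<close> gaps, the last one possibly cut; the \<open>m - 1\<close> gaps
  between its 0's are contained in full. Truncated subtraction makes the lower bound trivial for
  \<open>m = 0\<close>, and \<open>take\<close> absorbs the case of fewer than \<open>m\<close>
  gaps.\<close>

lemma count_prefix_word_of_gaps:
  assumes "prefix B (replicate r True @ word_of_gaps a)"
  shows "count_list B True \<le> r + sum_list (take (count_list B False) a)"
    and "count_list B False \<le> length a + 1"
    and "sum_list (take (count_list B False - 1) a) \<le> count_list B True"
proof -
  have "count_list B True \<le> r + sum_list (take (count_list B False) a) \<and>
    count_list B False \<le> length a + 1 \<and>
    sum_list (take (count_list B False - 1) a) \<le> count_list B True"
    using assms
  proof (induction a arbitrary: r B)
    case Nil
    then show ?case
      by (elim prefix_replicate_appendE) (auto simp: count_list_replicate prefix_Cons)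
  next
    case (Cons g a)
    from Cons.prems show ?case
    proof (cases rule: prefix_replicate_appendE)
      case (1 i)
      then show ?thesis by (simp add: count_list_replicate)
    next
      case (2 B')
      show ?thesis
      proof (cases B')
        case Nil
        with 2 show ?thesis by (simp add: count_list_replicate)
      next
        case (Cons b C)
        with 2 have "\<not> b" and C: "prefix C (replicate g True @ word_of_gaps a)"
          by auto
        \<comment> \<open>This is the third bound for \<open>B\<close>, where \<open>C\<close>
          follows the first 0. The induction hypothesis for \<open>C\<close> does not count the gap
          \<open>g\<close>; but if \<open>C\<close> contains a 0 it contains all of this gap, and
          the hypothesis for the rest \<open>D\<close> covers the others.\<close>
        have le: "sum_list (take (count_list C False) (g # a)) \<le> count_list C True"
          using C
        proof (cases rule: prefix_replicate_appendE)
          case (1 i)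
          then show ?thesis by (simp add: count_list_replicate)
        next
          case (2 D)
          show ?thesis
          proof (cases "count_list C False")
            case (Suc j)
            have "prefix D (replicate 0 True @ word_of_gaps a)" using 2 by simp
            from Cons.IH[OF this] 2 Suc show ?thesis by (simp add: count_list_replicate)
          qed simp
        qed
        show ?thesis
          using Cons.IH[OF C] le 2 \<open>B' = b # C\<close> \<open>\<not> b\<close> by (simp add: count_list_replicate)
      qed
    qed
  qed
  then show "count_list B True \<le> r + sum_list (take (count_list B False) a)"
    and "count_list B False \<le> length a + 1"
    and "sum_list (take (count_list B False - 1) a) \<le> count_list B True"
    by auto
qed

text \<open>The witness consists of the gaps enclosed by 0's of \<open>B\<close>, all of whose 1's
  belong to \<open>B\<close>; it is empty if \<open>B\<close> has at most one 0.\<close>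

lemma sublist_word_of_gaps_lower:
  assumes "sublist B (word_of_gaps a)"
  shows "\<exists>x. sublist x a \<and> length x = count_list B False - 1 \<and> sum_list x \<le> count_list B True"
proof -
  obtain r a' where pre: "prefix B (replicate r True @ word_of_gaps a')"
    and suf: "r = 0 \<and> suffix a' a \<or> (\<exists>g\<ge>r. suffix (g # a') a)"
    using assms by (rule sublist_word_of_gapsE)
  have "suffix a' a" using suf by (auto dest: suffix_ConsD)
  then have "sublist (take (count_list B False - 1) a') a"
    by (meson sublist_order.order.trans suffix_imp_sublist sublist_take)
  moreover have "length (take (count_list B False - 1) a') = count_list B False - 1"
    using count_prefix_word_of_gaps(2)[OF pre] by simp
  ultimately show ?thesis using count_prefix_word_of_gaps(3)[OF pre] by blast
qed

text \<open>The 0's of \<open>B\<close> cut its 1's into at most one more block than there are 0's,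
  and each block lies in one gap. The length is only bounded above because the gap list may end
  earlier.\<close>

lemma sublist_word_of_gaps_upper:
  assumes "sublist B (word_of_gaps a)"
  shows "\<exists>y. sublist y a \<and> length y \<le> count_list B False + 1 \<and> count_list B True \<le> sum_list y"
proof -
  obtain r a' where pre: "prefix B (replicate r True @ word_of_gaps a')"
    and suf: "r = 0 \<and> suffix a' a \<or> (\<exists>g\<ge>r. suffix (g # a') a)"
    using assms by (rule sublist_word_of_gapsE)
  from suf obtain b where "suffix b a"
    and "count_list B True \<le> sum_list (take (count_list B False + 1) b)"
  proof (elim disjE exE conjE)
    assume "r = 0" "suffix a' a"
    \<comment> \<open>No gap is cut on the left here, so one gap fewer would do; a further one is
      taken to match the other case, where the cut gap \<open>g\<close> comes first.\<close>
    have "sum_list (take n a') \<le> sum_list (take (n + 1) a')" for n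
      by (metis append_take_drop_id take_add sum_list.append le_add1)
    then show thesis
      using that[OF \<open>suffix a' a\<close>] count_prefix_word_of_gaps(1)[OF pre] \<open>r = 0\<close>
      by (metis add_0 le_trans)
  next
    fix g assume "r \<le> g" "suffix (g # a') a"
    then show thesis
      using that[of "g # a'"] count_prefix_word_of_gaps(1)[OF pre] by simp
  qed
  then show ?thesis
    by (intro exI[of _ "take (count_list B False + 1) b"])
      (auto intro: sublist_order.order.trans suffix_imp_sublist)
qed

section \<open>Balance of a word and of its gap list\<close>

lemma balanced_word_of_gaps_imp:
  assumes "balanced (word_of_gaps a)"
  shows "balanced_nats a"
  unfolding balanced_nats_def
proof (intro allI impI, rule ccontr)
  fix x y assume x: "sublist x a" and y: "sublist y a" and len: "length x = length y"
    and "\<not> sum_list y \<le> sum_list x + 1"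
  then have gt: "sum_list x + 2 \<le> sum_list y" by simp
  \<comment> \<open>Without its two outer 0's the word of \<open>y\<close> has
    \<open>length y - 1\<close> 0's and, by the excess 2 of the sum, is still at least as long as
    the word of \<open>x\<close>. A factor \<open>J\<close> of it of the latter length has at least
    two 0's fewer than the word of \<open>x\<close>, which has \<open>length x + 1\<close>.\<close>
  define I where "I = butlast (tl (word_of_gaps y))"
  have y': "word_of_gaps y = False # I @ [False]"
  proof -
    obtain g z where "y = g # z" using gt by (cases y) auto
    moreover obtain u where "word_of_gaps y = u @ [False]"
      by (cases y rule: rev_cases) (auto simp: word_of_gaps_snoc)
    ultimately show ?thesis unfolding I_def
      by (cases u) (auto split: if_splits)
  qed
  have cI: "count_list I False + 1 = length y"
    using count_False_word_of_gaps[of y] by (simp add: y')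
  define J where "J = take (length (word_of_gaps x)) I"
  have "length (word_of_gaps x) \<le> length I"
    using length_word_of_gaps[of x] length_word_of_gaps[of y] gt len by (simp add: y')
  then have lenJ: "length J = length (word_of_gaps x)" by (simp add: J_def)
  have cJ: "count_list J False \<le> count_list I False"
    unfolding J_def by (metis append_take_drop_id count_list_append le_add1)
  have "sublist J (word_of_gaps y)"
    unfolding y' J_def
    by (metis sublist_order.order.trans sublist_take sublist_appendI append_Cons append_Nil)
  then have "sublist J (word_of_gaps a)"
    using sublist_word_of_gaps[OF y] sublist_order.order.trans by blast
  then have "\<bar>int (count_list (word_of_gaps x) False) - int (count_list J False)\<bar> \<le> 1"
    using assms sublist_word_of_gaps[OF x] lenJ unfolding balanced_def by simp
  then show False using cI cJ len by (simp add: count_False_word_of_gaps)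
qed

text \<open>If \<open>A\<close> had at least two more 0's than an equally long \<open>B\<close>,
  then \<open>B\<close> would have at least two more 1's. But \<open>A\<close> encloses at least as
  many gaps as are needed to cover the 1's of \<open>B\<close>, so balance of the gaps allows
  \<open>B\<close> at most one 1 more.\<close>

lemma balanced_nats_imp:
  assumes "balanced_nats a"
  shows "balanced (word_of_gaps a)"
proof -
  have le: "count_list A False \<le> count_list B False + 1"
    if A: "sublist A (word_of_gaps a)" and B: "sublist B (word_of_gaps a)"
      and len: "length A = length B" for A B
  proof (rule ccontr)
    assume gt: "\<not> ?thesis"
    obtain x where x: "sublist x a" "length x = count_list A False - 1"
      "sum_list x \<le> count_list A True"
      using sublist_word_of_gaps_lower[OF A] by blast
    obtain y where y: "sublist y a" "length y \<le> count_list B False + 1"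
      "count_list B True \<le> sum_list y"
      using sublist_word_of_gaps_upper[OF B] by blast
    \<comment> \<open>Here \<open>x\<close> has at least as many entries as \<open>y\<close>;
      shortening it to the same number makes the balance condition applicable and cannot increase
      its sum.\<close>
    define z where "z = take (length y) x"
    have "length z = length y" using x y gt by (simp add: z_def)
    moreover have "sublist z a" using x(1) sublist_take sublist_order.order.trans unfolding z_def by blast
    ultimately have "sum_list y \<le> sum_list z + 1"
      using assms y(1) unfolding balanced_nats_def by metis
    moreover have "sum_list z \<le> sum_list x"
      unfolding z_def by (metis append_take_drop_id sum_list.append le_add1)
    moreover have "count_list A False + count_list A True = count_list B False + count_list B True"
      using len by (simp add: length_eq_count_list_bool)
    ultimately show False using x(3) y(3) gt by linarith
  qed
  show ?thesis
    unfolding balanced_def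
  proof (intro allI impI)
    fix u v assume "sublist u (word_of_gaps a)" "sublist v (word_of_gaps a)" "length u = length v"
    then show "\<bar>int (count_list u False) - int (count_list v False)\<bar> \<le> 1"
      using le[of u v] le[of v u] by linarith
  qed
qed

lemma balanced_word_of_gaps: "balanced (word_of_gaps a) \<longleftrightarrow> balanced_nats a"
  using balanced_word_of_gaps_imp balanced_nats_imp by blast

section \<open>Gap lists with two neighbouring values\<close>

lemma sublist_map_iff: "sublist x (map f u) \<longleftrightarrow> (\<exists>v. sublist v u \<and> x = map f v)"
proof
  assume "sublist x (map f u)"
  then obtain p s where "map f u = p @ x @ s" by (auto simp: sublist_def)
  then show "\<exists>v. sublist v u \<and> x = map f v"
    by (metis append_eq_map_conv map_eq_append_conv sublist_appendI)
next
  assume "\<exists>v. sublist v u \<and> x = map f v"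
  then show "sublist x (map f u)" by (metis map_append sublist_def)
qed

lemma sum_list_map_of_bool:
  "sum_list (map (\<lambda>b. k + of_bool b) u) = k * length u + height u"
  by (induction u) (auto simp: height_def)

text \<open>On factors of equal length the contributions of \<open>k\<close> cancel, leaving the
  difference of the heights; this is the difference of the numbers of 0's with the sign
  reversed.\<close>

lemma balanced_nats_map: "balanced_nats (map (\<lambda>b. k + of_bool b) u) \<longleftrightarrow> balanced u"
proof -
  have eq: "int (height x) - int (height y) = int (count_list y False) - int (count_list x False)"
    if "length x = length y" for x y
    using that by (simp add: length_eq_count_list_bool height_def)
  have "balanced_nats (map (\<lambda>b. k + of_bool b) u) \<longleftrightarrow>
    (\<forall>x y. sublist x u \<longrightarrow> sublist y u \<longrightarrow> length x = length y \<longrightarrow> height y \<le> height x + 1)"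
  proof -
    have "(\<forall>x y. sublist x (map f u) \<longrightarrow> sublist y (map f u) \<longrightarrow> P x y) \<longleftrightarrow>
      (\<forall>x y. sublist x u \<longrightarrow> sublist y u \<longrightarrow> P (map f x) (map f y))"
      for f :: "bool \<Rightarrow> nat" and P
      unfolding sublist_map_iff by blast
    then show ?thesis
      unfolding balanced_nats_def by (simp add: sum_list_map_of_bool cong: imp_cong)
  qed
  also have "\<dots> \<longleftrightarrow> balanced u"
  proof
    assume *: "\<forall>x y. sublist x u \<longrightarrow> sublist y u \<longrightarrow> length x = length y \<longrightarrow> height y \<le> height x + 1"
    show "balanced u" unfolding balanced_def
    proof (intro allI impI)
      fix x y assume "sublist x u" "sublist y u" "length x = length y"
      then have "height y \<le> height x + 1" "height x \<le> height y + 1" using * by auto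
      then show "\<bar>int (count_list x False) - int (count_list y False)\<bar> \<le> 1"
        using eq[OF \<open>length x = length y\<close>] by linarith
    qed
  next
    assume *: "balanced u"
    show "\<forall>x y. sublist x u \<longrightarrow> sublist y u \<longrightarrow> length x = length y \<longrightarrow> height y \<le> height x + 1"
    proof (intro allI impI)
      fix x y assume "sublist x u" "sublist y u" "length x = length y"
      then have "\<bar>int (count_list x False) - int (count_list y False)\<bar> \<le> 1"
        using * unfolding balanced_def by blast
      then show "height y \<le> height x + 1"
        using eq[OF \<open>length x = length y\<close>] by linarith
    qed
  qed
  finally show ?thesis .
qed

text \<open>By factors of length one, any two entries differ by at most 1. Let \<open>k\<close> be
  the mean rounded down. An entry below \<open>k\<close> forces all others to be at most
  \<open>k\<close>, and the sum is too small; an entry above \<open>k + 1\<close> forces all others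
  to be at least \<open>k + 1\<close>, and the sum is too large.\<close>

lemma balanced_nats_entries:
  assumes "balanced_nats a" "g \<in> set a"
  shows "g = sum_list a div length a \<or> g = sum_list a div length a + 1"
proof -
  define k where "k = sum_list a div length a"
  have n: "length a > 0" using assms(2) by (auto intro: length_pos_if_in_set)
  have sub: "sublist [x] a" if "x \<in> set a" for x
    using split_list[OF that] by (auto simp: sublist_def)
  have diff: "y \<le> x + 1" if "x \<in> set a" "y \<in> set a" for x y
    using assms(1) sub[OF that(1)] sub[OF that(2)] unfolding balanced_nats_def by force
  have lt: "sum_list a < (k + 1) * length a"
    unfolding k_def using n by (simp add: dividend_less_div_times)
  have ge: "k * length a \<le> sum_list a"
    unfolding k_def by simp
  obtain b c where "a = b @ g # c" using split_list[OF assms(2)] by blast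
  then have "set (b @ c) \<subseteq> set a" "sum_list a = g + sum_list (b @ c)"
    "length a = length (b @ c) + 1"
    by auto
  then obtain d where d: "set d \<subseteq> set a"
    and split: "sum_list a = g + sum_list d" "length a = length d + 1"
    by blast
  have "k \<le> g"
  proof (rule ccontr)
    assume "\<not> k \<le> g"
    then have "\<forall>x\<in>set d. x \<le> k" and "g < k"
      using diff[OF assms(2)] d by fastforce+
    moreover from this(1) have "sum_list d \<le> k * length d"
      using sum_list_mono[of d "\<lambda>x. x" "\<lambda>_. k"] by (simp add: sum_list_triv mult.commute)
    moreover have "k * length a = k * length d + k" using split(2) by simp
    ultimately show False using split(1) ge by linarith
  qed
  moreover have "g \<le> k + 1"
  proof (rule ccontr)
    assume "\<not> g \<le> k + 1"
    then have "\<forall>x\<in>set d. k + 1 \<le> x" and "k + 1 < g"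
      using diff[OF _ assms(2)] d by fastforce+
    moreover from this(1) have "(k + 1) * length d \<le> sum_list d"
      using sum_list_mono[of d "\<lambda>_. k + 1" "\<lambda>x. x"] by (simp add: sum_list_triv mult.commute)
    moreover have "(k + 1) * length a = (k + 1) * length d + (k + 1)"
      using split(2) by simp
    ultimately show False using split(1) lt by linarith
  qed
  ultimately show ?thesis unfolding k_def by linarith
qed

section \<open>Balanced palindromes starting with 0\<close>

lemma bal_pals_start_0_bij:
  assumes "0 < h" "h + 1 < L"
  defines "n \<equiv> L - h - 1"
  defines "\<phi> \<equiv> \<lambda>u. word_of_gaps (map (\<lambda>b. h div n + of_bool b) u)"
  shows "bij_betw \<phi> (bal_pals n (h mod n)) {w \<in> bal_pals L h. \<not> hd w}"
  unfolding bij_betw_def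
proof (intro conjI equalityI subsetI)
  define f where "f = (\<lambda>b. h div n + of_bool b :: nat)"
  have inj: "inj f" by (auto simp: inj_def f_def)
  have \<phi>: "\<phi> u = word_of_gaps (map f u)" for u by (simp add: \<phi>_def f_def)
  \<comment> \<open>The word has \<open>L - h\<close> 0's, so \<open>n\<close> is the number of its
    gaps and \<open>h div n\<close> the mean gap rounded down.\<close>
  have L: "L = h + n + 1" using assms(2) by (simp add: n_def)
  have n: "n > 0" using assms(2) by (simp add: n_def)
  show "inj_on \<phi> (bal_pals n (h mod n))"
    using inj by (auto simp: inj_on_def \<phi> inj_map_eq_map)
  have iff: "\<phi> u \<in> bal_pals L h \<longleftrightarrow> u \<in> bal_pals n (h mod n)" if "length u = n" for u
  proof -
    have "sum_list (map f u) = h \<longleftrightarrow> height u = h mod n"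
      unfolding f_def sum_list_map_of_bool that
      by (metis add_left_cancel mult_div_mod_eq mult.commute)
    moreover have "rev (map f u) = map f u \<longleftrightarrow> rev u = u"
      by (simp only: rev_map inj_map_eq_map[OF inj])
    moreover have "balanced_nats (map f u) \<longleftrightarrow> balanced u"
      unfolding f_def by (rule balanced_nats_map)
    ultimately show ?thesis
      using that
      by (auto simp: bal_pals_def \<phi> balanced_word_of_gaps palindrome_word_of_gaps
        length_word_of_gaps height_def[of "word_of_gaps _"] count_True_word_of_gaps L
        palindrome_def[of u])
  qed
  {
    fix w assume "w \<in> \<phi> ` bal_pals n (h mod n)"
    then obtain u where "w = \<phi> u" "u \<in> bal_pals n (h mod n)" by blast
    with iff[of u] show "w \<in> {w \<in> bal_pals L h. \<not> hd w}"
      by (auto simp: bal_pals_def \<phi>)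
  }
  {
    fix w assume w: "w \<in> {w \<in> bal_pals L h. \<not> hd w}"
    then have "w \<noteq> []" "\<not> hd w" using assms(2) by (auto simp: bal_pals_def)
    moreover have "\<not> last w"
      using w by (auto simp: bal_pals_def palindrome_def) (metis \<open>w \<noteq> []\<close> hd_rev)
    ultimately obtain a where a: "w = word_of_gaps a" using ex_word_of_gaps by blast
    with w have sum: "sum_list a = h" and len: "length a = n" and "balanced_nats a"
      by (auto simp: bal_pals_def balanced_word_of_gaps length_word_of_gaps height_def
        count_True_word_of_gaps L)
    \<comment> \<open>Each gap is \<open>h div n\<close> or one more, so the preimage has the letter
      1 exactly at the larger gaps.\<close>
    then have "\<forall>g\<in>set a. f (g \<noteq> h div n) = g"
      using balanced_nats_entries by (fastforce simp: f_def)
    then have "map f (map (\<lambda>g. g \<noteq> h div n) a) = a"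
      by (simp add: map_idI)
    then have "w = \<phi> (map (\<lambda>g. g \<noteq> h div n) a)" by (simp add: a \<phi>)
    then show "w \<in> \<phi> ` bal_pals n (h mod n)"
      using iff[of "map (\<lambda>g. g \<noteq> h div n) a"] w len by auto
  }
qed

lemma card_bal_pals_start_0:
  assumes "0 < h" "h < L"
  shows "card {w \<in> bal_pals L h. \<not> hd w} = p (int L - int h - 1) (int h)"
proof (cases "h + 1 < L")
  case True
  then have n: "int L - int h - 1 = int (L - h - 1)" "0 < L - h - 1" by auto
  have "card {w \<in> bal_pals L h. \<not> hd w} = card (bal_pals (L - h - 1) (h mod (L - h - 1)))"
    using bij_betw_same_card[OF bal_pals_start_0_bij[OF assms(1) True]] by simp
  \<comment> \<open>The reduction of the height modulo \<open>L - h - 1\<close> is built into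
    \<open>p\<close>.\<close>
  also have "\<dots> = p (int (L - h - 1)) (int h)"
    using n(2) by (simp add: p_def nat_mod_distrib del: of_nat_diff)
  finally show ?thesis by (simp only: n(1))
next
  case False
  with assms have L: "L = h + 1" by simp
  \<comment> \<open>A word with a single 0 that starts and ends with 0 has no gaps, hence no 1's,
    although \<open>h > 0\<close>. The right-hand side is \<open>p 0 h\<close>, which is 0 by
    definition.\<close>
  have "{w \<in> bal_pals L h. \<not> hd w} = {}"
  proof (rule ccontr)
    assume "\<not> ?thesis"
    then obtain w where w: "balanced w" "rev w = w" "length w = L" "count_list w True = h" "\<not> hd w"
      by (auto simp: bal_pals_def palindrome_def height_def)
    then have "w \<noteq> []" "\<not> last w" using L by (auto, metis hd_rev list.size(3) Suc_neq_Zero)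
    with w obtain a where "w = word_of_gaps a" using ex_word_of_gaps by blast
    with w L have "length a = 0" "sum_list a = h"
      by (auto simp: length_word_of_gaps count_True_word_of_gaps)
    with assms(1) show False by simp
  qed
  then show ?thesis unfolding L p_def using assms(1) by (simp only: card.empty) simp
qed

section \<open>Exchange of the two letters\<close>

lemma count_list_map_Not: "count_list (map Not w) b = count_list w (\<not> b)"
  by (induction w) auto

lemma balanced_map_Not:
  assumes "balanced w"
  shows "balanced (map Not w)"
  unfolding balanced_def sublist_map_iff
proof (intro allI impI, elim exE conjE)
  fix u v u' v' assume "sublist u' w" "sublist v' w" "u = map Not u'" "v = map Not v'"
    "length u = length v"
  moreover from this have "\<bar>int (count_list u' False) - int (count_list v' False)\<bar> \<le> 1"
    using assms unfolding balanced_def by simp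
  ultimately show "\<bar>int (count_list u False) - int (count_list v False)\<bar> \<le> 1"
    by (simp add: count_list_map_Not length_eq_count_list_bool)
qed

lemma map_Not_bal_pals:
  assumes "w \<in> bal_pals L h"
  shows "map Not w \<in> bal_pals L (L - h)"
  using assms length_eq_count_list_bool[of w]
  by (auto simp: bal_pals_def palindrome_def height_def balanced_map_Not count_list_map_Not rev_map)

text \<open>\<open>map Not\<close> is its own inverse and flips the first letter, which exists
  because \<open>0 < L\<close>.\<close>

lemma card_bal_pals_start_1:
  assumes "h \<le> L" "0 < L"
  shows "card {w \<in> bal_pals L h. hd w} = card {w \<in> bal_pals L (L - h). \<not> hd w}"
proof (rule bij_betw_same_card[of "map Not"], rule bij_betw_byWitness[where f' = "map Not"])
  have hd: "hd (map Not w) \<longleftrightarrow> \<not> hd w" if "w \<in> bal_pals L k" for w k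
    using that assms(2) by (cases w) (auto simp: bal_pals_def)
  show "map Not ` {w \<in> bal_pals L h. hd w} \<subseteq> {w \<in> bal_pals L (L - h). \<not> hd w}"
    using map_Not_bal_pals hd by auto
  show "map Not ` {w \<in> bal_pals L (L - h). \<not> hd w} \<subseteq> {w \<in> bal_pals L h. hd w}"
    using map_Not_bal_pals[of _ L "L - h"] hd assms(1) by auto
qed (auto simp: comp_def)

section \<open>Trivial heights and the recursion\<close>

lemma finite_bal_pals: "finite (bal_pals L h)"
  by (rule finite_subset[OF _ finite_lists_length_eq[of UNIV L]]) (auto simp: bal_pals_def)

lemma bal_pals_0: "bal_pals L 0 = {replicate L False}"
proof -
  have "w = replicate (length w) False" if "count_list w True = 0" for w
    using that by (induction w) (auto split: if_splits)
  then have "bal_pals L 0 \<subseteq> {replicate L False}"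
    by (auto simp: bal_pals_def height_def)
  moreover have "count_list u False = length u" if "sublist u (replicate L False)" for u
  proof -
    have "True \<notin> set u" using set_mono_sublist[OF that] by auto
    then show ?thesis by (simp add: length_eq_count_list_bool count_notin)
  qed
  then have "balanced (replicate L False)" by (simp add: balanced_def)
  then have "replicate L False \<in> bal_pals L 0"
    by (simp add: bal_pals_def palindrome_def height_def count_list_replicate)
  ultimately show ?thesis by blast
qed

theorem theorem20:
  fixes L h :: int
  shows "p L h =
    (if L < 0 \<or> (L = 0 \<and> h \<noteq> 0) then 0
     else if L \<ge> 0 \<and> (h = 0 \<or> h = L) then 1
     else if L > 0 \<and> (h < 0 \<or> h > L) then p L (h mod L)
     else p (L - h - 1) h + p (h - 1) (L - 1))"
proof -
  have main: "p L h = p (L - h - 1) h + p (h - 1) (L - 1)" if hL: "0 < h" "h < L"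
  proof -
    define l k where "l = nat L" and "k = nat h"
    have [simp]: "L = int l" "h = int k" and kl: "0 < k" "k < l"
      using hL by (auto simp: l_def k_def)
    have "p L h = card (bal_pals l k)" using kl by (simp add: p_def)
    also have "bal_pals l k = {w \<in> bal_pals l k. \<not> hd w} \<union> {w \<in> bal_pals l k. hd w}" by auto
    also have "card \<dots> = card {w \<in> bal_pals l k. \<not> hd w} + card {w \<in> bal_pals l k. hd w}"
      by (rule card_Un_disjoint) (auto simp: finite_bal_pals)
    also have "card {w \<in> bal_pals l k. \<not> hd w} = p (L - h - 1) h"
      using card_bal_pals_start_0[OF kl] by simp
    \<comment> \<open>Exchanging letters changes the height to \<open>L - h\<close>, so the first
      argument becomes \<open>L - (L - h) - 1 = h - 1\<close>.\<close>
    also have "card {w \<in> bal_pals l k. hd w} = p (h - 1) (L - h)"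
      using card_bal_pals_start_1[of k l] card_bal_pals_start_0[of "l - k" l] kl
      by (simp add: of_nat_diff)
    \<comment> \<open>The second arguments differ by the modulus \<open>h - 1\<close>; for
      \<open>h = 1\<close> they coincide.\<close>
    also have "p (h - 1) (L - h) = p (h - 1) (L - 1)"
    proof -
      have "(L - h) mod (h - 1) = (L - 1) mod (h - 1)"
        using mod_add_self2[of "L - h" "h - 1"] by simp
      then show ?thesis using hL by (simp add: p_def)
    qed
    finally show ?thesis .
  qed
  \<comment> \<open>For \<open>L > 0\<close> both heights are 0 modulo \<open>L\<close>, and only
    the word of \<open>L\<close> 0's is counted; for \<open>L = 0\<close> the value is
    \<open>p 0 0 = 1\<close>.\<close>
  moreover have "p L h = 1" if "L \<ge> 0" "h = 0 \<or> h = L"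
    using that by (auto simp: p_def bal_pals_0)
  moreover have "p L h = p L (h mod L)" if "L > 0"
    using that by (simp add: p_def)
  moreover have "p L h = 0" if "L < 0 \<or> (L = 0 \<and> h \<noteq> 0)"
    using that by (auto simp: p_def)
  ultimately show ?thesis by (smt (verit))
qed

end
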